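(* Let $n$ be prime, let $1\le m\le 2n$, and let $A$ be chosen uniformly at random from the collection of subsets of size $m$ of the dihedral group $D_{2n}=\langle r,s\mid r^n,s^2,rsrs\rangle$ of order $2n$. Then $$\mathbb{E}[|A-A|]=2n-\frac{nm2^m\binom{n}{m}+2n(n-1)\binom{n-m-1}{m-1}}{m\binom{2n}{m}}-\frac{n^2(n-1)}{\binom{2n}{m}}\sum_{k=1}^{m-1}\frac{\binom{n+k-m-1}{m-k-1}\binom{n-k-1}{k-1}}{k(m-k)}.$$
   Context: For a subset $A$ of a (multiplicatively written) group, $A-A=\{a_1a_2^{-1}:a_1,a_2\in A\}$. Convention: for integers $a$ and $b\ge 0$, $\binom ab=0$ whenever $a<b$, including when $a$ is negative. *)

theory Defs
  imports "HOL-Probability.Probability" "HOL-Algebra.Coset"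
begin

text \<open>
  Group presentations. A word is a list of letters \<open>(x, e)\<close>, where \<open>(x, True)\<close> stands for the
  generator \<open>x\<close> and \<open>(x, False)\<close> for its formal inverse. Two words represent the same element of
  the group with generating type \<open>'g\<close> and set of relators \<open>R\<close> iff one is obtained from the other
  by inserting and deleting factors \<open>x x\<inverse>\<close>, \<open>x\<inverse> x\<close> and relators.
\<close>

type_synonym 'g word = "('g \<times> bool) list"

inductive word_eq :: "'g word set \<Rightarrow> 'g word \<Rightarrow> 'g word \<Rightarrow> bool" for R where
  refl: "word_eq R u u"
| sym: "word_eq R u v \<Longrightarrow> word_eq R v u"
| trans: "word_eq R u v \<Longrightarrow> word_eq R v w \<Longrightarrow> word_eq R u w"
| cancel: "word_eq R (u @ [(x, e), (x, \<not> e)] @ v) (u @ v)"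
| relator: "w \<in> R \<Longrightarrow> word_eq R (u @ w @ v) (u @ v)"

definition word_class :: "'g word set \<Rightarrow> 'g word \<Rightarrow> 'g word set" where
  "word_class R u = {v. word_eq R u v}"

definition presented_group :: "'g word set \<Rightarrow> 'g word set monoid" where
  "presented_group R =
     \<lparr>carrier = range (word_class R),
      mult = (\<lambda>X Y. {w. \<exists>u\<in>X. \<exists>v\<in>Y. word_eq R (u @ v) w}),
      one = word_class R []\<rparr>"

datatype dihedral_gen = Rot | Flip

text \<open>The dihedral group \<open>\<langle>r, s | r\<^sup>n, s\<^sup>2, rsrs\<rangle>\<close> with \<open>r = Rot\<close> and \<open>s = Flip\<close>.\<close>

definition dihedral_relators :: "nat \<Rightarrow> dihedral_gen word set" where
  "dihedral_relators n =
     {replicate n (Rot, True),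
      [(Flip, True), (Flip, True)],
      [(Rot, True), (Flip, True), (Rot, True), (Flip, True)]}"

definition dihedral_group :: "nat \<Rightarrow> dihedral_gen word set monoid" where
  "dihedral_group n = presented_group (dihedral_relators n)"

definition difference_set :: "('a, 'b) monoid_scheme \<Rightarrow> 'a set \<Rightarrow> 'a set" where
  "difference_set G A = {a\<^sub>1 \<otimes>\<^bsub>G\<^esub> inv\<^bsub>G\<^esub> a\<^sub>2 | a\<^sub>1 a\<^sub>2. a\<^sub>1 \<in> A \<and> a\<^sub>2 \<in> A}"

definition subsets_of_size :: "'a set \<Rightarrow> nat \<Rightarrow> 'a set set" where
  "subsets_of_size X m = {A. A \<subseteq> X \<and> finite A \<and> card A = m}"

text \<open>
  Binomial coefficient with an integer upper index, zero whenever \<open>a < b\<close>. It differs from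
  \<open>gchoose\<close> for negative \<open>a\<close>; in particular its value at \<open>a < 0\<close>, \<open>b = 0\<close> is 0.
\<close>

definition ibinom :: "int \<Rightarrow> nat \<Rightarrow> nat" where
  "ibinom a b = (if a < int b then 0 else nat a choose b)"

lemma word_eq_append:
  assumes "word_eq R u v"
  shows "word_eq R (a @ u @ b) (a @ v @ b)"
  using assms
proof (induction rule: word_eq.induct)
  case (cancel u x e v)
  show ?case using word_eq.cancel[of R "a @ u" x e "v @ b"] by simp
next
  case (relator w u v)
  then show ?case using word_eq.relator[of w R "a @ u" "v @ b"] by simp
qed (blast intro: word_eq.intros)+

lemma word_eq_append2:
  assumes "word_eq R u u'" "word_eq R v v'"
  shows "word_eq R (u @ v) (u' @ v')"
  using word_eq_append[OF assms(1), of "[]" v] word_eq_append[OF assms(2), of u' "[]"]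
  by (auto intro: word_eq.trans)

declare word_eq.trans [trans]

lemma word_class_eq_iff: "word_class R u = word_class R v \<longleftrightarrow> word_eq R u v"
  unfolding word_class_def by (auto intro: word_eq.intros)

lemma mult_word_class:
  "word_class R u \<otimes>\<^bsub>presented_group R\<^esub> word_class R v = word_class R (u @ v)"
proof -
  have "word_eq R (u @ v) w" if "word_eq R u u'" "word_eq R v v'" "word_eq R (u' @ v') w" for u' v' w
    using word_eq_append2[OF that(1,2)] that(3) by (rule word_eq.trans)
  then show ?thesis
    unfolding word_class_def presented_group_def by (auto intro: word_eq.refl)
qed

definition inv_word :: "'g word \<Rightarrow> 'g word" where
  "inv_word w = rev (map (\<lambda>(x, e). (x, \<not> e)) w)"

lemma word_eq_inv_left: "word_eq R (inv_word w @ w) []"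
proof (induction w)
  case Nil
  show ?case by (simp add: inv_word_def word_eq.refl)
next
  case (Cons a w)
  obtain x e where a: "a = (x, e)" by (cases a)
  have "word_eq R (inv_word w @ [(x, \<not> e), (x, \<not> \<not> e)] @ w) (inv_word w @ w)"
    by (rule word_eq.cancel)
  with Cons show ?case by (auto simp: inv_word_def a intro: word_eq.trans)
qed

lemma carrier_presented_group: "carrier (presented_group R) = range (word_class R)"
  and one_presented_group: "\<one>\<^bsub>presented_group R\<^esub> = word_class R []"
  by (simp_all add: presented_group_def)

lemma group_presented_group: "group (presented_group R)"
proof (rule groupI)
  fix x assume "x \<in> carrier (presented_group R)"
  then obtain w where "x = word_class R w" by (auto simp: carrier_presented_group)
  then have "word_class R (inv_word w) \<otimes>\<^bsub>presented_group R\<^esub> x = \<one>\<^bsub>presented_group R\<^esub>"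
    by (simp add: mult_word_class one_presented_group word_class_eq_iff word_eq_inv_left)
  then show "\<exists>y\<in>carrier (presented_group R). y \<otimes>\<^bsub>presented_group R\<^esub> x = \<one>\<^bsub>presented_group R\<^esub>"
    by (auto simp: carrier_presented_group)
qed (auto simp: carrier_presented_group one_presented_group mult_word_class)

lemma group_dihedral_group: "group (dihedral_group n)"
  by (simp add: dihedral_group_def group_presented_group)

text \<open>
  The normal form \<open>r\<^sup>i s\<^sup>b\<close> is computed by letting words act on pairs \<open>(i, b)\<close> from the left.
\<close>

fun dihedral_act :: "nat \<Rightarrow> dihedral_gen \<times> bool \<Rightarrow> int \<times> bool \<Rightarrow> int \<times> bool" where
  "dihedral_act n (Rot, e) (i, b) = ((if e then i + 1 else i - 1) mod int n, b)"
| "dihedral_act n (Flip, e) (i, b) = ((- i) mod int n, \<not> b)"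

definition dihedral_nf :: "int \<times> bool \<Rightarrow> dihedral_gen word" where
  "dihedral_nf p = replicate (nat (fst p)) (Rot, True) @ (if snd p then [(Flip, True)] else [])"

abbreviation dihedral_val :: "nat \<Rightarrow> dihedral_gen word \<Rightarrow> int \<times> bool" where
  "dihedral_val n w \<equiv> foldr (dihedral_act n) w (0, False)"

lemma dihedral_act_range:
  "n > 0 \<Longrightarrow> dihedral_act n a p \<in> {0..<int n} \<times> UNIV"
  by (cases "(n, a, p)" rule: dihedral_act.cases) auto

lemma foldr_dihedral_act_range:
  "n > 0 \<Longrightarrow> p \<in> {0..<int n} \<times> UNIV \<Longrightarrow> foldr (dihedral_act n) w p \<in> {0..<int n} \<times> UNIV"
  by (induction w) (simp_all add: dihedral_act_range del: mem_Sigma_iff)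

lemma dihedral_act_Rot_funpow:
  "0 \<le> i \<Longrightarrow> i < int n \<Longrightarrow> (dihedral_act n (Rot, True) ^^ k) (i, b) = ((i + int k) mod int n, b)"
  by (induction k) (simp_all add: mod_simps algebra_simps)

lemma foldr_dihedral_act_cong:
  assumes "n > 0" "word_eq (dihedral_relators n) u v" "p \<in> {0..<int n} \<times> UNIV"
  shows "foldr (dihedral_act n) u p = foldr (dihedral_act n) v p"
  using assms(2,3)
proof (induction arbitrary: p rule: word_eq.induct)
  case (cancel u x e v)
  have "foldr (dihedral_act n) v p \<in> {0..<int n} \<times> UNIV"
    using foldr_dihedral_act_range assms(1) cancel by blast
  then show ?case
    by (cases "foldr (dihedral_act n) v p"; cases x; cases e) (auto simp: mod_simps)
next
  case (relator w u v)
  have "foldr (dihedral_act n) v p \<in> {0..<int n} \<times> UNIV"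
    using foldr_dihedral_act_range assms(1) relator by blast
  then show ?case using relator
    by (cases "foldr (dihedral_act n) v p")
       (auto simp: mod_simps dihedral_relators_def dihedral_act_Rot_funpow)
qed auto

lemma dihedral_val_nf:
  assumes "p \<in> {0..<int n} \<times> UNIV"
  shows "dihedral_val n (dihedral_nf p) = p"
  using assms by (cases p) (auto simp: dihedral_nf_def dihedral_act_Rot_funpow)

lemma word_eq_Cons: "word_eq R u v \<Longrightarrow> word_eq R (a # u) (a # v)"
  using word_eq_append[of R u v "[a]" "[]"] by simp

lemma word_eq_dihedral:
  fixes n :: nat
  defines "W \<equiv> word_eq (dihedral_relators n)"
  shows "W (replicate n (Rot, True) @ v) v"
    and "W ((Flip, True) # (Flip, True) # v) v"
    and "W ((Flip, False) # v) ((Flip, True) # v)"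
    and "W ((Flip, True) # (Rot, True) # v) ((Rot, False) # (Flip, True) # v)"
proof -
  have rel: "W (w @ v) v" if "w \<in> dihedral_relators n" for w v
    using word_eq.relator[OF that, of "[]" v] unfolding W_def by simp
  have can: "W ((x, e) # (x, \<not> e) # v) v" for x e v
    using word_eq.cancel[of _ "[]" x e v] unfolding W_def by simp
  have tr: "W u w" if "W u v" "W v w" for u v w using that unfolding W_def by (rule word_eq.trans)
  have sy: "W u v" if "W v u" for u v using that unfolding W_def by (rule word_eq.sym)
  have co: "W (a # u) (a # v)" if "W u v" for a u v
    using that unfolding W_def by (rule word_eq_Cons)
  show "W (replicate n (Rot, True) @ v) v" by (rule rel) (simp add: dihedral_relators_def)
  have ss: "W ((Flip, True) # (Flip, True) # v) v" for v
    using rel[of "[(Flip, True), (Flip, True)]" v] by (simp add: dihedral_relators_def)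
  then show "W ((Flip, True) # (Flip, True) # v) v" .
  show "W ((Flip, False) # v) ((Flip, True) # v)"
    using tr[OF co[OF sy[OF ss]] can[of Flip False "(Flip, True) # v", simplified]] .
  have rsrs: "W ((Rot, True) # (Flip, True) # (Rot, True) # (Flip, True) # v) v" for v
    using rel[of "[(Rot, True), (Flip, True), (Rot, True), (Flip, True)]" v]
    by (simp add: dihedral_relators_def)
  have "W ((Flip, True) # (Rot, True) # (Flip, True) # v) ((Rot, False) # v)" for v
    using tr[OF sy[OF can[of Rot False, simplified]] co[OF rsrs]] .
  from tr[OF co[OF co[OF sy[OF ss]]] this]
  show "W ((Flip, True) # (Rot, True) # v) ((Rot, False) # (Flip, True) # v)" .
qed

lemma word_eq_Rot_nf:
  assumes "0 \<le> i" "i < int n"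
  shows "word_eq (dihedral_relators n) ((Rot, e) # dihedral_nf (i, b))
           (dihedral_nf (dihedral_act n (Rot, e) (i, b)))"
proof (cases e)
  case True
  show ?thesis
  proof (cases "i + 1 = int n")
    case last: True
    with assms have "Suc (nat i) = n" by linarith
    then have "(Rot, e) # dihedral_nf (i, b) =
               replicate n (Rot, True) @ (if b then [(Flip, True)] else [])"
      using True by (auto simp: dihedral_nf_def)
    moreover have "dihedral_nf (dihedral_act n (Rot, e) (i, b)) = (if b then [(Flip, True)] else [])"
      using last True by (simp add: dihedral_nf_def)
    ultimately show ?thesis using word_eq_dihedral(1) by metis
  next
    case False
    with assms have "(i + 1) mod int n = i + 1" "nat (i + 1) = Suc (nat i)" by simp_all
    with True show ?thesis by (simp add: dihedral_nf_def word_eq.refl)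
  qed
next
  case False
  show ?thesis
  proof (cases "i = 0")
    case True
    let ?v = "if b then [(Flip, True)] else []"
    obtain k where k: "n = Suc k" using assms by (cases n) auto
    have "(- 1) mod int n = int k" using k by (simp add: zmod_minus1)
    moreover have "word_eq (dihedral_relators n) ((Rot, False) # ?v) (replicate k (Rot, True) @ ?v)"
    proof (rule word_eq.trans)
      show "word_eq (dihedral_relators n) ((Rot, False) # ?v)
              ((Rot, False) # (Rot, True) # replicate k (Rot, True) @ ?v)"
        using word_eq_Cons[OF word_eq.sym[OF word_eq_dihedral(1)[of n ?v]], of "(Rot, False)"]
        by (simp add: k)
      show "word_eq (dihedral_relators n)
              ((Rot, False) # (Rot, True) # replicate k (Rot, True) @ ?v) (replicate k (Rot, True) @ ?v)"
        using word_eq.cancel[of _ "[]" Rot False] by simp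
    qed
    ultimately show ?thesis using True False by (simp add: dihedral_nf_def)
  next
    case pos: False
    with assms have "(i - 1) mod int n = i - 1" "nat i = Suc (nat (i - 1))" by simp_all
    with False word_eq.cancel[of "dihedral_relators n" "[]" Rot False "dihedral_nf (i - 1, b)"]
    show ?thesis by (simp add: dihedral_nf_def)
  qed
qed

lemma word_eq_Refl_nf:
  assumes "i < n"
  shows "word_eq (dihedral_relators n) ((Flip, True) # dihedral_nf (int i, b))
           (dihedral_nf (dihedral_act n (Flip, True) (int i, b)))"
  using assms
proof (induction i)
  case 0
  show ?case
    using word_eq_dihedral(2)[of n "[]"] by (simp add: dihedral_nf_def word_eq.refl)
next
  case (Suc i)
  let ?W = "word_eq (dihedral_relators n)"
  have "dihedral_nf (int (Suc i), b) = (Rot, True) # dihedral_nf (int i, b)"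
    by (simp add: dihedral_nf_def nat_add_distrib)
  then have "?W ((Flip, True) # dihedral_nf (int (Suc i), b))
                ((Rot, False) # (Flip, True) # dihedral_nf (int i, b))"
    using word_eq_dihedral(4) by simp
  also   have "?W \<dots> ((Rot, False) # dihedral_nf (dihedral_act n (Flip, True) (int i, b)))"
    by (rule word_eq_Cons) (use Suc in simp)
  also   have "?W \<dots> (dihedral_nf (dihedral_act n (Rot, False) (dihedral_act n (Flip, True) (int i, b))))"
    using word_eq_Rot_nf[of "(- int i) mod int n" n False "\<not> b"] Suc.prems by simp
  finally show ?case by (simp add: mod_simps minus_diff_commute)
qed

lemma word_eq_dihedral_nf_val:
  assumes "n > 0"
  shows "word_eq (dihedral_relators n) w (dihedral_nf (dihedral_val n w))"
proof (induction w)
  case Nil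
  show ?case by (simp add: dihedral_nf_def word_eq.refl)
next
  case (Cons a w)
  obtain i b where ib: "dihedral_val n w = (i, b)" by fastforce
  with foldr_dihedral_act_range[OF assms, of "(0, False)" w] assms
  have i: "0 \<le> i" "i < int n" by auto
  obtain x e where a: "a = (x, e)" by (cases a)
  let ?W = "word_eq (dihedral_relators n)"
  have 1: "?W (a # w) (a # dihedral_nf (i, b))"
    using word_eq_Cons[OF Cons] ib by simp
  have 2: "?W (a # dihedral_nf (i, b)) (dihedral_nf (dihedral_act n a (i, b)))"
  proof (cases x)
    case Rot
    with word_eq_Rot_nf[OF i] a show ?thesis by simp
  next
    case Flip
    have "?W (a # dihedral_nf (i, b)) ((Flip, True) # dihedral_nf (i, b))"
      using word_eq_dihedral(3) a Flip by (cases e) (auto intro: word_eq.refl)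
    moreover have "?W ((Flip, True) # dihedral_nf (i, b)) (dihedral_nf (dihedral_act n a (i, b)))"
      using word_eq_Refl_nf[of "nat i" n b] i a Flip by simp
    ultimately show ?thesis by (rule word_eq.trans)
  qed
  from word_eq.trans[OF 1 2] show ?case by (simp add: ib)
qed

lemma order_dihedral_group:
  assumes "n > 0"
  shows "order (dihedral_group n) = 2 * n"
proof -
  let ?P = "{0..<int n} \<times> (UNIV :: bool set)"
  let ?c = "word_class (dihedral_relators n)"
  have "bij_betw (\<lambda>p. ?c (dihedral_nf p)) ?P (carrier (dihedral_group n))"
  proof (rule bij_betw_imageI)
    show "inj_on (\<lambda>p. ?c (dihedral_nf p)) ?P"
    proof (rule inj_onI)
      fix p q assume pq: "p \<in> ?P" "q \<in> ?P" "?c (dihedral_nf p) = ?c (dihedral_nf q)"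
      then have "dihedral_val n (dihedral_nf p) = dihedral_val n (dihedral_nf q)"
        using assms by (intro foldr_dihedral_act_cong) (auto simp: word_class_eq_iff)
      with pq show "p = q" by (simp only: dihedral_val_nf)
    qed
    have "?c w \<in> (\<lambda>p. ?c (dihedral_nf p)) ` ?P" for w
    proof
      show "?c w = ?c (dihedral_nf (dihedral_val n w))"
        using word_eq_dihedral_nf_val[OF assms] by (simp add: word_class_eq_iff)
      show "dihedral_val n w \<in> ?P" using assms by (intro foldr_dihedral_act_range) auto
    qed
    then show "(\<lambda>p. ?c (dihedral_nf p)) ` ?P = carrier (dihedral_group n)"
      by (auto simp: dihedral_group_def carrier_presented_group)
  qed
  from bij_betw_same_card[OF this] show ?thesis
    by (simp add: order_def card_cartesian_product)
qed

end

theory Submission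
  imports Defs "HOL-Computational_Algebra.Polynomial" "HOL-Algebra.Multiplicative_Group"
begin

text \<open>
  By linearity of expectation, the expected size of \<open>A - A\<close> is \<open>2n\<close> minus the sum, over all group
  elements \<open>g\<close>, of the probability that \<open>g\<close> is not a difference of \<open>A\<close>. Now \<open>g\<close> is a difference
  iff \<open>A\<close> contains some \<open>a\<close> together with \<open>g a\<close>. So \<open>g\<close> is missed exactly when \<open>A\<close> is an independent
  set of the graph joining every \<open>x\<close> to \<open>g x\<close>, and the task is to count the independent sets of
  size \<open>m\<close> in these graphs.

  Left translation by \<open>g\<close> permutes the group in cycles of length \<open>ord g\<close>, one on each right coset of
  the subgroup generated by \<open>g\<close>. Independence is checked cycle by cycle, so the generating function
  of the independent sets by size is a power of the one of a single cycle
  (\<open>indep_poly_translation\<close>). Deleting a vertex reduces cycles to paths and gives the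
  classical count \<open>n/k \<cdot> binom (n-k-1) (k-1)\<close> of independent \<open>k\<close>-sets in an \<open>n\<close>-cycle
  (\<open>coeff_cycle_poly\<close>).

  In the dihedral group with \<open>n\<close> prime there are three kinds of elements. The identity is always a
  difference, as \<open>A\<close> is nonempty. Each of the \<open>n\<close> reflections has order 2 and decomposes the group
  into \<open>n\<close> pairs, so that the generating function is \<open>(1 + 2X)\<^sup>n\<close>. Each of the \<open>n - 1\<close> other rotations
  has order \<open>n\<close> and decomposes it into two \<open>n\<close>-cycles; in the square of the cycle's generating
  function, the two extreme terms of the convolution, where one cycle receives no point, give the
  isolated binomial coefficient of the formula, and the remaining terms give its sum over \<open>k\<close>.
\<close>

(* Here coeff and monom are those of the type of univariate polynomials. *)
hide_const (open) UnivPoly.coeff UnivPoly.monom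

section \<open>Independence polynomials of functional graphs\<close>

text \<open>
  The graph is given by a function \<open>f\<close>, with edges \<open>{x, f x}\<close>. The vertex set need not be closed
  under \<open>f\<close>: edges leaving it impose no condition, so that restricting \<open>X\<close> is passing to the
  induced subgraph.
\<close>

definition indep_sets :: "('a \<Rightarrow> 'a) \<Rightarrow> 'a set \<Rightarrow> 'a set set" where
  "indep_sets f X = {A. A \<subseteq> X \<and> (\<forall>a\<in>A. f a \<notin> A)}"

definition indep_poly :: "('a \<Rightarrow> 'a) \<Rightarrow> 'a set \<Rightarrow> nat poly" where
  "indep_poly f X = (\<Sum>A\<in>indep_sets f X. monom 1 (card A))"

lemma finite_indep_sets: "finite X \<Longrightarrow> finite (indep_sets f X)"
  by (rule finite_subset[of _ "Pow X"]) (auto simp: indep_sets_def)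

lemma coeff_indep_poly:
  assumes "finite X"
  shows "coeff (indep_poly f X) k = card {A \<in> indep_sets f X. card A = k}"
proof -
  have "coeff (indep_poly f X) k = (\<Sum>A\<in>indep_sets f X. if card A = k then 1 else 0)"
    by (simp add: indep_poly_def coeff_sum del: One_nat_def)
  also have "\<dots> = card {A \<in> indep_sets f X. card A = k}"
    by (simp add: sum.If_cases finite_indep_sets assms Int_def del: One_nat_def)
  finally show ?thesis .
qed

lemma indep_poly_empty [simp]: "indep_poly f {} = 1"
proof -
  have "indep_sets f {} = {{}}" by (auto simp: indep_sets_def)
  then show ?thesis by (simp add: indep_poly_def del: One_nat_def)
qed

lemma indep_poly_cong:
  assumes "\<And>x. x \<in> X \<Longrightarrow> f x = g x"
  shows "indep_poly f X = indep_poly g X"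
proof -
  have "indep_sets f X = indep_sets g X"
    unfolding indep_sets_def using assms by (metis (no_types, opaque_lifting) subsetD)
  then show ?thesis by (simp add: indep_poly_def)
qed

lemma indep_poly_image:
  assumes inj: "inj_on h X" and closed: "f ` X \<subseteq> X"
    and comm: "\<And>x. x \<in> X \<Longrightarrow> g (h x) = h (f x)"
  shows "indep_poly g (h ` X) = indep_poly f X"
proof -
  have iff: "g (h a) \<in> h ` A \<longleftrightarrow> f a \<in> A" if "A \<subseteq> X" "a \<in> A" for A a
  proof -
    have "f a \<in> X" "a \<in> X" using closed that by auto
    then show ?thesis
      using inj that comm by (auto simp: inj_on_image_mem_iff)
  qed
  have sets: "indep_sets g (h ` X) = (`) h ` indep_sets f X"
  proof (intro equalityI subsetI)
    fix B assume B: "B \<in> indep_sets g (h ` X)"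
    then obtain A where A: "A \<subseteq> X" "B = h ` A"
      unfolding indep_sets_def by (auto simp: subset_image_iff)
    with B iff have "A \<in> indep_sets f X"
      unfolding indep_sets_def by auto
    with A show "B \<in> (`) h ` indep_sets f X" by blast
  next
    fix B assume "B \<in> (`) h ` indep_sets f X"
    then obtain A where A: "A \<in> indep_sets f X" "B = h ` A" by blast
    with iff[of A] show "B \<in> indep_sets g (h ` X)"
      unfolding indep_sets_def by auto
  qed
  have "inj_on ((`) h) (indep_sets f X)"
    by (rule inj_on_subset[OF inj_on_image_Pow[OF inj]]) (auto simp: indep_sets_def)
  then have "indep_poly g (h ` X) = (\<Sum>A\<in>indep_sets f X. monom 1 (card (h ` A)))"
    unfolding indep_poly_def sets by (simp add: sum.reindex)
  also have "\<dots> = indep_poly f X"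
    unfolding indep_poly_def
    by (rule sum.cong) (auto simp: indep_sets_def card_image[OF inj_on_subset[OF inj]])
  finally show ?thesis .
qed

text \<open>
  Between two closed parts there are no edges, so an independent set of the union is an arbitrary
  pair of independent sets of the parts, and sizes add up.
\<close>

lemma indep_poly_Un:
  assumes fin: "finite X" "finite Y" and disj: "X \<inter> Y = {}"
    and closed: "f ` X \<subseteq> X" "f ` Y \<subseteq> Y"
  shows "indep_poly f (X \<union> Y) = indep_poly f X * indep_poly f Y"
proof -
  have "indep_poly f X * indep_poly f Y =
      (\<Sum>(A, B)\<in>indep_sets f X \<times> indep_sets f Y. monom 1 (card A + card B))"
    by (simp add: indep_poly_def sum_product sum.cartesian_product mult_monom)
  also have "\<dots> = indep_poly f (X \<union> Y)"
    unfolding indep_poly_def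
  proof (rule sum.reindex_bij_witness[where i = "\<lambda>C. (C \<inter> X, C \<inter> Y)" and j = "\<lambda>(A, B). A \<union> B"])
    fix p assume p: "p \<in> indep_sets f X \<times> indep_sets f Y"
    then obtain A B where AB: "p = (A, B)" "A \<in> indep_sets f X" "B \<in> indep_sets f Y" by auto
    then have sub: "A \<subseteq> X" "B \<subseteq> Y" by (auto simp: indep_sets_def)
    with disj show "(\<lambda>C. (C \<inter> X, C \<inter> Y)) ((\<lambda>(A, B). A \<union> B) p) = p"
      by (auto simp: AB)
    have "f a \<notin> A \<union> B" if "a \<in> A \<union> B" for a
      using that AB sub closed disj unfolding indep_sets_def by blast
    with sub show "(\<lambda>(A, B). A \<union> B) p \<in> indep_sets f (X \<union> Y)"
      by (auto simp: AB indep_sets_def)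
    have "card (A \<union> B) = card A + card B"
      using sub fin disj by (intro card_Un_disjoint) (auto intro: finite_subset)
    then show "monom 1 (card ((\<lambda>(A, B). A \<union> B) p)) = (case p of (A, B) \<Rightarrow> monom (1::nat) (card A + card B))"
      by (simp add: AB)
  qed (auto simp: indep_sets_def)
  finally show ?thesis ..
qed

lemma indep_poly_Union:
  assumes "finite P" and "\<And>X. X \<in> P \<Longrightarrow> finite X" and "pairwise disjnt P"
    and "\<And>X. X \<in> P \<Longrightarrow> f ` X \<subseteq> X"
  shows "indep_poly f (\<Union>P) = (\<Prod>X\<in>P. indep_poly f X)"
  using assms
proof (induction P rule: finite_induct)
  case (insert X P)
  have "X \<inter> \<Union>P = {}"
    using insert.prems(2) insert.hyps(2) by (auto simp: pairwise_insert disjnt_def)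
  moreover have "f ` \<Union>P \<subseteq> \<Union>P" using insert.prems(3) by blast
  ultimately have "indep_poly f (X \<union> \<Union>P) = indep_poly f X * indep_poly f (\<Union>P)"
    using insert by (intro indep_poly_Un) auto
  with insert show ?case by (simp add: pairwise_insert)
qed simp

text \<open>
  The deletion recurrence of independence polynomials: the independent sets avoiding \<open>x\<close> live on
  \<open>X - {x}\<close>; those containing \<open>x\<close> arise by adding \<open>x\<close> to an independent set that avoids the closed
  neighbourhood of \<open>x\<close>.
\<close>

lemma indep_poly_delete:
  assumes fin: "finite X" and x: "x \<in> X" "f x \<noteq> x"
  shows "indep_poly f X = indep_poly f (X - {x})
           + monom 1 1 * indep_poly f {y \<in> X. y \<noteq> x \<and> y \<noteq> f x \<and> f y \<noteq> x}"
proof -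
  let ?Y = "{y \<in> X. y \<noteq> x \<and> y \<noteq> f x \<and> f y \<noteq> x}"
  have split: "indep_sets f X = indep_sets f (X - {x}) \<union> insert x ` indep_sets f ?Y" (is "_ = _ \<union> ?I")
  proof (intro equalityI subsetI)
    fix A assume A: "A \<in> indep_sets f X"
    show "A \<in> indep_sets f (X - {x}) \<union> ?I"
    proof (cases "x \<in> A")
      case True
      then have "A = insert x (A - {x})" "A - {x} \<in> indep_sets f ?Y"
        using A by (auto simp: indep_sets_def)
      then show ?thesis by blast
    qed (use A in \<open>auto simp: indep_sets_def\<close>)
  qed (use x in \<open>auto simp: indep_sets_def\<close>)
  have inj: "inj_on (insert x) (indep_sets f ?Y)"
    by (rule inj_onI) (auto simp: indep_sets_def dest!: insert_ident[THEN iffD1, rotated 2])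
  have "indep_poly f X = indep_poly f (X - {x}) + (\<Sum>A\<in>?I. monom 1 (card A))"
    unfolding indep_poly_def split
    by (rule sum.union_disjoint) (use fin in \<open>auto simp: finite_indep_sets indep_sets_def\<close>)
  also have "(\<Sum>A\<in>?I. monom 1 (card A)) = (\<Sum>A\<in>indep_sets f ?Y. monom (1::nat) 1 * monom 1 (card A))"
    unfolding sum.reindex[OF inj] o_def
  proof (rule sum.cong)
    fix A assume "A \<in> indep_sets f ?Y"
    then have "A \<subseteq> ?Y" by (simp add: indep_sets_def)
    with fin have "finite A" "x \<notin> A" by (auto intro: finite_subset)
    then show "monom (1::nat) (card (insert x A)) = monom 1 1 * monom 1 (card A)"
      by (simp add: mult_monom)
  qed simp
  finally show ?thesis by (simp add: indep_poly_def sum_distrib_left)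
qed

section \<open>Paths and cycles\<close>

text \<open>
  Deleting the last vertex of a path turns the deletion recurrence into Pascal's rule. Truncated
  subtraction makes the formula correct for the empty path and for every \<open>k\<close>.
\<close>

lemma coeff_indep_poly_path:
  "coeff (indep_poly Suc {a..<b}) k = (b - a + 1 - k) choose k"
proof (induction "b - a" arbitrary: b k rule: less_induct)
  case less
  show ?case
  proof (cases "a < b")
    case False
    then show ?thesis by (cases k) auto
  next
    case True
    then obtain b' where b: "b = Suc b'" "a \<le> b'" by (cases b) auto
    have minus: "{a..<b} - {b'} = {a..<b'}"
      using b by auto
    have nbr: "{y \<in> {a..<b}. y \<noteq> b' \<and> y \<noteq> Suc b' \<and> Suc y \<noteq> b'} = {a..<b' - 1}"
      using b by auto
    have "indep_poly Suc {a..<b} = indep_poly Suc {a..<b'} + monom 1 1 * indep_poly Suc {a..<b' - 1}"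
      using indep_poly_delete[of "{a..<b}" b' Suc] b unfolding minus nbr by simp
    then have rec: "coeff (indep_poly Suc {a..<b}) k = coeff (indep_poly Suc {a..<b'}) k
        + (if k = 0 then 0 else coeff (indep_poly Suc {a..<b' - 1}) (k - 1))"
      by (simp add: coeff_monom_mult)
    have IH: "coeff (indep_poly Suc {a..<b'}) k = (b' - a + 1 - k) choose k"
      "coeff (indep_poly Suc {a..<b' - 1}) j = (b' - 1 - a + 1 - j) choose j" for j
      by (rule less.hyps; use b in simp)+
    show ?thesis
    proof (cases k)
      case 0
      with rec IH show ?thesis by simp
    next
      case k: (Suc j)
      have "coeff (indep_poly Suc {a..<b}) k = (b' - a + 1 - k choose k) + (b' - 1 - a + 1 - j choose j)"
        using rec IH k by simp
      also have "\<dots> = (b - a + 1 - k choose k)"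
      proof (cases "b' - a \<ge> k")
        case True
        then have "b - a + 1 - k = Suc (b' - a + 1 - k)" "b' - 1 - a + 1 - j = b' - a + 1 - k"
          using b k by auto
        then show ?thesis using k by simp
      next
        case False
        show ?thesis
        (* All three coefficients vanish, except for a single vertex and k = 1. *)
        proof (cases "b' = a \<and> j = 0")
          case True
          with b k show ?thesis by simp
        next
          case neq: False
          with False b k have "b' - a + 1 - k < k" "b' - 1 - a + 1 - j < j" "b - a + 1 - k < k"
            by auto
          then show ?thesis by (simp only: binomial_eq_0)
        qed
      qed
      finally show ?thesis .
    qed
  qed
qed

definition cycle_poly :: "nat \<Rightarrow> nat poly" where
  "cycle_poly n = indep_poly (\<lambda>i. (i + 1) mod n) {..<n}"

text \<open>
  Deleting the vertex \<open>n - 1\<close> leaves a path on \<open>n - 1\<close> vertices; deleting its neighbours \<open>0\<close> and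
  \<open>n - 2\<close> as well leaves a path on \<open>n - 3\<close>. For \<open>n = 2\<close> the two neighbours coincide and the second
  path is empty, as is \<open>{1..<n - 2}\<close>.
\<close>

lemma cycle_poly_eq:
  assumes "n \<ge> 2"
  shows "cycle_poly n =
    indep_poly Suc {0..<n - 1} + monom 1 1 * indep_poly Suc {1..<n - 2}"
proof -
  let ?f = "\<lambda>i. (i + 1) mod n"
  have f: "?f y = (if y = n - 1 then 0 else Suc y)" if "y < n" for y
    using that assms by auto
  have minus: "{..<n} - {n - 1} = {0..<n - 1}" using assms by auto
  have nbr: "{y \<in> {..<n}. y \<noteq> n - 1 \<and> y \<noteq> ?f (n - 1) \<and> ?f y \<noteq> n - 1} = {1..<n - 2}"
  proof (intro equalityI subsetI)
    fix y assume "y \<in> {y \<in> {..<n}. y \<noteq> n - 1 \<and> y \<noteq> ?f (n - 1) \<and> ?f y \<noteq> n - 1}"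
    with f[of y] f[of "n - 1"] assms show "y \<in> {1..<n - 2}" by auto
  next
    fix y assume "y \<in> {1..<n - 2}"
    with f[of y] f[of "n - 1"] assms
    show "y \<in> {y \<in> {..<n}. y \<noteq> n - 1 \<and> y \<noteq> ?f (n - 1) \<and> ?f y \<noteq> n - 1}" by auto
  qed
  have "cycle_poly n = indep_poly ?f {0..<n - 1} + monom 1 1 * indep_poly ?f {1..<n - 2}"
    using indep_poly_delete[of "{..<n}" "n - 1" ?f] assms f[of "n - 1"]
    unfolding minus nbr cycle_poly_def by simp
  moreover have "indep_poly ?f {0..<n - 1} = indep_poly Suc {0..<n - 1}"
    by (rule indep_poly_cong) auto
  moreover have "indep_poly ?f {1..<n - 2} = indep_poly Suc {1..<n - 2}"
    by (rule indep_poly_cong) auto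
  ultimately show ?thesis by simp
qed

lemma coeff_cycle_poly_0:
  assumes "n \<ge> 2"
  shows "coeff (cycle_poly n) 0 = 1"
  by (simp add: cycle_poly_eq[OF assms] coeff_monom_mult coeff_indep_poly_path del: One_nat_def)

text \<open>
  The two paths of \<open>cycle_poly_eq\<close> contribute \<open>binom (n-k) k + binom (n-k-1) (k-1)\<close>. Multiplying by
  \<open>k\<close>, absorption rewrites the first summand as \<open>(n-k) binom (n-k-1) (k-1)\<close>, whence the factor \<open>n\<close>.
\<close>

lemma coeff_cycle_poly:
  assumes n: "n \<ge> 2" and k: "k \<ge> 1"
  shows "k * coeff (cycle_poly n) k = n * ibinom (int n - int k - 1) (k - 1)"
proof -
  have "coeff (cycle_poly n) k = (n - k choose k) + (n - 2 - 1 + 1 - (k - 1) choose (k - 1))"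
    using n k by (simp add: cycle_poly_eq coeff_monom_mult coeff_indep_poly_path del: One_nat_def)
  also have "(n - 2 - 1 + 1 - (k - 1) choose (k - 1)) = (n - k - 1 choose (k - 1))"
  proof (cases "n = 2")
    case True
    with k show ?thesis by (cases "k = 1"; cases "k = 2") auto
  next
    case False
    with n k have "n - 2 - 1 + 1 - (k - 1) = n - k - 1" by auto
    then show ?thesis by simp
  qed
  finally have c: "coeff (cycle_poly n) k = (n - k choose k) + (n - k - 1 choose (k - 1))" .
  have "k * coeff (cycle_poly n) k = (n - k + k) * (n - k - 1 choose (k - 1))"
    unfolding c add_mult_distrib add_mult_distrib2
    using times_binomial_minus1_eq[of k "n - k"] k by simp
  also have "\<dots> = n * ibinom (int n - int k - 1) (k - 1)"
  proof (cases "k < n")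
    case True
    then have "nat (int n - int k - 1) = n - k - 1" by auto
    moreover have "(int n - int k - 1 < int (k - 1)) = (n - k - 1 < k - 1)" using True k by auto
    ultimately show ?thesis using True by (simp add: ibinom_def)
  next
    case False
    with n k show ?thesis by (simp add: ibinom_def)
  qed
  finally show ?thesis .
qed

lemma cycle_poly_2: "cycle_poly 2 = [:1, 2:]"
proof -
  have "cycle_poly 2 = indep_poly Suc {0..<1} + monom 1 1"
    by (simp add: cycle_poly_eq)
  moreover have "coeff (indep_poly Suc {0..<1}) k = coeff [:1, 1:] k" for k
    unfolding coeff_indep_poly_path
    by (cases k) (auto simp: coeff_pCons split: nat.split)
  then have "indep_poly Suc {0..<1} = [:1, 1:]" by (rule poly_eqI)
  ultimately show ?thesis by (simp add: monom_altdef)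
qed

section \<open>Translations of a finite group\<close>

text \<open>
  On a right coset with representative \<open>x\<close>, the map from \<open>i\<close> to \<open>g\<^sup>i x\<close> identifies the standard cycle
  of length \<open>ord g\<close> with the action of \<open>g\<close>.
\<close>

lemma (in group) indep_poly_translation_coset:
  assumes fin: "finite (carrier G)" and g: "g \<in> carrier G" and C: "C \<in> rcosets (generate G {g})"
  shows "(\<lambda>x. g \<otimes> x) ` C \<subseteq> C" and "indep_poly (\<lambda>x. g \<otimes> x) C = cycle_poly (ord g)"
proof -
  obtain x where x: "x \<in> carrier G" "C = generate G {g} #> x"
    using C by (auto simp: RCOSETS_def)
  let ?h = "\<lambda>i::nat. g [^] i \<otimes> x"
  have d: "ord g > 0" using ord_ge_1[OF fin g] by simp
  have "{0..ord g - 1} = {..<ord g}" using d by auto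
  with ord_elems[OF fin g] generate_pow_on_finite_carrier[OF fin g]
  have "generate G {g} = (\<lambda>i::nat. g [^] i) ` {..<ord g}"
    by auto
  then have C_eq: "C = ?h ` {..<ord g}" by (auto simp: x r_coset_def)
  have inj: "inj_on ?h {..<ord g}"
  proof (rule inj_onI)
    fix i j assume ij: "i \<in> {..<ord g}" "j \<in> {..<ord g}" "?h i = ?h j"
    then have "g [^] i = g [^] j" using g x by simp
    with ord_inj[OF g] ij show "i = j" by (auto simp: inj_on_def)
  qed
  have comm: "g \<otimes> ?h i = ?h ((i + 1) mod ord g)" for i
  proof -
    have "g [^] (i + 1) = g [^] (ord g * ((i + 1) div ord g) + (i + 1) mod ord g)"
      by simp
    also have "\<dots> = g [^] ((i + 1) mod ord g)"
      using g by (simp only: nat_pow_mult[symmetric] nat_pow_pow[symmetric] pow_ord_eq_1 nat_pow_one) simp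
    finally have "g [^] (i + 1) = g [^] ((i + 1) mod ord g)" .
    moreover have "g \<otimes> ?h i = g [^] (i + 1) \<otimes> x"
      using g x by (simp add: m_assoc[symmetric] nat_pow_Suc2[symmetric])
    ultimately show ?thesis by simp
  qed
  show "(\<lambda>x. g \<otimes> x) ` C \<subseteq> C"
    using comm d by (auto simp: C_eq)
  show "indep_poly (\<lambda>x. g \<otimes> x) C = cycle_poly (ord g)"
    unfolding C_eq cycle_poly_def
    by (rule indep_poly_image[OF inj]) (use comm d in auto)
qed

text \<open>
  The cosets are closed under translation by \<open>g\<close> and partition the group, so the polynomials of the
  single cosets multiply.
\<close>

lemma (in group) indep_poly_translation:
  assumes fin: "finite (carrier G)" and g: "g \<in> carrier G" and order: "Coset.order G = ord g * q"
  shows "indep_poly (\<lambda>x. g \<otimes> x) (carrier G) = cycle_poly (ord g) ^ q"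
proof -
  let ?H = "generate G {g}"
  have sub: "subgroup ?H G" using g by (intro generate_is_subgroup) auto
  have d: "ord g > 0" using ord_ge_1[OF fin g] by simp
  have "card (rcosets ?H) * ord g = ord g * q"
    using lagrange_finite[OF fin sub] order generate_pow_card[OF g] by simp
  with d have q: "card (rcosets ?H) = q" by simp
  have "indep_poly (\<lambda>x. g \<otimes> x) (\<Union>(rcosets ?H)) = (\<Prod>C\<in>rcosets ?H. indep_poly (\<lambda>x. g \<otimes> x) C)"
    by (rule indep_poly_Union)
       (use fin sub rcosets_subset_PowG[OF sub] rcos_disjoint indep_poly_translation_coset(1)[OF fin g]
        in \<open>auto intro: finite_subset\<close>)
  also have "\<dots> = cycle_poly (ord g) ^ q"
    by (simp add: indep_poly_translation_coset(2)[OF fin g] q)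
  finally show ?thesis by (simp add: rcosets_part_G[OF sub])
qed

lemma (in group) mem_difference_set_iff:
  assumes "A \<subseteq> carrier G" "g \<in> carrier G"
  shows "g \<in> difference_set G A \<longleftrightarrow> (\<exists>a\<in>A. g \<otimes> a \<in> A)"
proof
  assume "g \<in> difference_set G A"
  then obtain a b where ab: "a \<in> A" "b \<in> A" "g = a \<otimes> inv b"
    by (auto simp: difference_set_def)
  with assms have "g \<otimes> b = a" by (metis inv_solve_right subsetD)
  with ab(1,2) show "\<exists>a\<in>A. g \<otimes> a \<in> A" by blast
next
  assume "\<exists>a\<in>A. g \<otimes> a \<in> A"
  then obtain b where b: "b \<in> A" "g \<otimes> b \<in> A" by blast
  with assms have "g = (g \<otimes> b) \<otimes> inv b" by (metis inv_solve_right subsetD)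
  with b show "g \<in> difference_set G A" unfolding difference_set_def by blast
qed

text \<open>
  Double counting of the pairs \<open>(A, g)\<close> with \<open>g\<close> not a difference of \<open>A\<close>: for fixed \<open>g\<close> the sets \<open>A\<close>
  are the independent sets of size \<open>m\<close> for the translation by \<open>g\<close>.
\<close>

lemma (in group) expectation_card_difference_set:
  assumes fin: "finite (carrier G)" and m: "m \<le> Coset.order G"
  shows "measure_pmf.expectation (pmf_of_set (subsets_of_size (carrier G) m))
           (\<lambda>A. real (card (difference_set G A)))
       = real (Coset.order G)
         - (\<Sum>g\<in>carrier G. real (coeff (indep_poly (\<lambda>x. g \<otimes> x) (carrier G)) m))
           / real (Coset.order G choose m)"
proof -
  let ?S = "subsets_of_size (carrier G) m"
  have S_eq: "?S = {A. A \<subseteq> carrier G \<and> card A = m}"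
    using fin by (auto simp: subsets_of_size_def intro: finite_subset)
  have cardS: "card ?S = Coset.order G choose m"
    unfolding S_eq order_def by (rule n_subsets[OF fin])
  have finS: "finite ?S"
    unfolding S_eq by (rule finite_subset[of _ "Pow (carrier G)"]) (use fin in auto)
  have pos: "card ?S > 0" using cardS m by simp
  then have neS: "?S \<noteq> {}" by auto
  have card_diff: "real (card (difference_set G A))
      = real (Coset.order G) - (\<Sum>g\<in>carrier G. if g \<in> difference_set G A then 0 else 1)"
    if "A \<in> ?S" for A
  proof -
    have "A \<subseteq> carrier G" using that by (auto simp: S_eq)
    then have sub: "difference_set G A \<subseteq> carrier G"
      by (auto simp: difference_set_def)
    have "(\<Sum>g\<in>carrier G. if g \<in> difference_set G A then 0 else 1)
        = real (card (carrier G - difference_set G A))"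
      using fin by (simp add: sum.If_cases Diff_eq)
    also have "\<dots> = real (Coset.order G) - real (card (difference_set G A))"
      using sub fin by (simp add: card_Diff_subset finite_subset card_mono of_nat_diff order_def)
    finally show ?thesis by simp
  qed
  have count: "(\<Sum>A\<in>?S. if g \<in> difference_set G A then 0 else 1)
      = real (coeff (indep_poly (\<lambda>x. g \<otimes> x) (carrier G)) m)" if g: "g \<in> carrier G" for g
  proof -
    have "(\<Sum>A\<in>?S. if g \<in> difference_set G A then 0 else 1)
        = real (card (?S \<inter> - {A. g \<in> difference_set G A}))"
      using finS by (simp add: sum.If_cases)
    also have "?S \<inter> - {A. g \<in> difference_set G A}
        = {A \<in> indep_sets (\<lambda>x. g \<otimes> x) (carrier G). card A = m}"
      unfolding S_eq indep_sets_def using mem_difference_set_iff[OF _ g] by blast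
    finally show ?thesis by (simp add: coeff_indep_poly[OF fin])
  qed
  have "(\<Sum>A\<in>?S. real (card (difference_set G A)))
      = (\<Sum>A\<in>?S. real (Coset.order G)
          - (\<Sum>g\<in>carrier G. if g \<in> difference_set G A then 0 else 1))"
    by (rule sum.cong) (simp_all add: card_diff)
  also have "\<dots> = real (card ?S) * real (Coset.order G)
      - (\<Sum>A\<in>?S. \<Sum>g\<in>carrier G. if g \<in> difference_set G A then 0 else 1)"
    by (simp add: sum_subtractf)
  also have "(\<Sum>A\<in>?S. \<Sum>g\<in>carrier G. if g \<in> difference_set G A then 0 else 1)
      = (\<Sum>g\<in>carrier G. real (coeff (indep_poly (\<lambda>x. g \<otimes> x) (carrier G)) m))"
    by (subst sum.swap) (simp add: count)
  finally show ?thesis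
    using pos by (simp add: integral_pmf_of_set[OF neS finS] cardS diff_divide_distrib)
qed

section \<open>Element orders in the dihedral group\<close>

definition rotation :: "nat \<Rightarrow> nat \<Rightarrow> dihedral_gen word set" where
  "rotation n i = word_class (dihedral_relators n) (dihedral_nf (int i, False))"

definition reflection :: "nat \<Rightarrow> nat \<Rightarrow> dihedral_gen word set" where
  "reflection n i = word_class (dihedral_relators n) (dihedral_nf (int i, True))"

text \<open>
  The action on normal forms decides equality of words, so identities in the presented group reduce
  to computing with pairs.
\<close>

lemma word_class_dihedral_eq_iff:
  assumes "n > 0"
  shows "word_class (dihedral_relators n) u = word_class (dihedral_relators n) v
           \<longleftrightarrow> dihedral_val n u = dihedral_val n v"
proof
  assume "word_class (dihedral_relators n) u = word_class (dihedral_relators n) v"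
  then show "dihedral_val n u = dihedral_val n v"
    using assms by (intro foldr_dihedral_act_cong) (auto simp: word_class_eq_iff)
next
  assume "dihedral_val n u = dihedral_val n v"
  then show "word_class (dihedral_relators n) u = word_class (dihedral_relators n) v"
    using word_eq_dihedral_nf_val[OF assms] unfolding word_class_eq_iff
    by (metis word_eq.sym word_eq.trans)
qed

lemma carrier_dihedral_group:
  assumes n: "n > 0"
  shows "carrier (dihedral_group n) = rotation n ` {..<n} \<union> reflection n ` {..<n}"
    and "inj_on (rotation n) {..<n}" and "inj_on (reflection n) {..<n}"
    and "rotation n ` {..<n} \<inter> reflection n ` {..<n} = {}"
proof -
  let ?c = "word_class (dihedral_relators n)"
  have val: "dihedral_val n (dihedral_nf (int i, b)) = (int i, b)" if "i < n" for i b
    using that by (intro dihedral_val_nf) auto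
  show "inj_on (rotation n) {..<n}" "inj_on (reflection n) {..<n}"
    by (auto simp: inj_on_def rotation_def reflection_def word_class_dihedral_eq_iff[OF n] val)
  show "rotation n ` {..<n} \<inter> reflection n ` {..<n} = {}"
    by (auto simp: rotation_def reflection_def word_class_dihedral_eq_iff[OF n] val)
  have carrier: "carrier (dihedral_group n) = range ?c"
    by (simp add: dihedral_group_def carrier_presented_group)
  have "?c w \<in> rotation n ` {..<n} \<union> reflection n ` {..<n}" for w
  proof -
    obtain i b where ib: "dihedral_val n w = (i, b)" by fastforce
    with foldr_dihedral_act_range[OF n, of "(0, False)" w] n have i: "0 \<le> i" "i < int n" by auto
    then obtain j where j: "i = int j" "j < n" by (metis nonneg_int_cases of_nat_less_iff)
    have "?c w = ?c (dihedral_nf (int j, b))"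
      using word_eq_dihedral_nf_val[OF n, of w] by (simp add: ib j word_class_eq_iff)
    also have "\<dots> \<in> rotation n ` {..<n} \<union> reflection n ` {..<n}"
      using j(2) by (cases b) (simp_all add: rotation_def reflection_def)
    finally show ?thesis .
  qed
  then show "carrier (dihedral_group n) = rotation n ` {..<n} \<union> reflection n ` {..<n}"
    unfolding carrier by (auto simp: rotation_def reflection_def)
qed

lemma rotation_0: "rotation n 0 = \<one>\<^bsub>dihedral_group n\<^esub>"
  by (simp add: rotation_def dihedral_nf_def dihedral_group_def one_presented_group)

lemma rotation_mult:
  "rotation n i \<otimes>\<^bsub>dihedral_group n\<^esub> rotation n j = rotation n (i + j)"
proof -
  have "dihedral_nf (int i, False) = replicate i (Rot, True)" for i
    by (simp add: dihedral_nf_def)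
  then show ?thesis
    by (simp only: rotation_def dihedral_group_def mult_word_class replicate_add)
qed

lemma rotation_pow:
  "rotation n i [^]\<^bsub>dihedral_group n\<^esub> (k::nat) = rotation n (i * k)"
proof -
  interpret group "dihedral_group n" by (rule group_dihedral_group)
  show ?thesis
    by (induction k) (simp_all add: rotation_0 rotation_mult add.commute)
qed

lemma rotation_mult_n:
  assumes "n > 0"
  shows "rotation n (i * n) = \<one>\<^bsub>dihedral_group n\<^esub>"
  unfolding rotation_0[symmetric] rotation_def word_class_dihedral_eq_iff[OF assms]
  using assms by (simp add: dihedral_nf_def dihedral_act_Rot_funpow nat_mult_distrib)

lemma reflection_sq:
  assumes n: "n > 0"
  shows "reflection n i \<otimes>\<^bsub>dihedral_group n\<^esub> reflection n i = \<one>\<^bsub>dihedral_group n\<^esub>"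
  unfolding reflection_def dihedral_group_def mult_word_class one_presented_group
    word_class_dihedral_eq_iff[OF n]
  using n by (simp add: dihedral_nf_def dihedral_act_Rot_funpow mod_simps)

lemma ord_reflection:
  assumes n: "n > 0" and i: "i < n"
  shows "group.ord (dihedral_group n) (reflection n i) = 2"
proof -
  interpret group "dihedral_group n" by (rule group_dihedral_group)
  have car: "reflection n i \<in> carrier (dihedral_group n)"
    using i by (simp add: carrier_dihedral_group(1)[OF n])
  have "reflection n i [^]\<^bsub>dihedral_group n\<^esub> (2::nat) = \<one>\<^bsub>dihedral_group n\<^esub>"
    using car by (simp add: numeral_2_eq_2 reflection_sq[OF n])
  then have "ord (reflection n i) dvd 2" using pow_eq_id[OF car] by simp
  moreover have "reflection n i \<noteq> \<one>\<^bsub>dihedral_group n\<^esub>"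
    using carrier_dihedral_group(4)[OF n] i n unfolding rotation_0[symmetric] by blast
  then have "ord (reflection n i) \<noteq> 1" using ord_eq_1[OF car] by simp
  ultimately show ?thesis using two_is_prime_nat by (auto simp: prime_nat_iff)
qed

lemma ord_rotation:
  assumes n: "prime n" and i: "0 < i" "i < n"
  shows "group.ord (dihedral_group n) (rotation n i) = n"
proof -
  interpret group "dihedral_group n" by (rule group_dihedral_group)
  have n0: "n > 0" using n by (simp add: prime_gt_0_nat)
  have car: "rotation n i \<in> carrier (dihedral_group n)"
    using i by (simp add: carrier_dihedral_group(1)[OF n0])
  have "ord (rotation n i) dvd n"
    using pow_eq_id[OF car, of n] by (simp add: rotation_pow rotation_mult_n[OF n0])
  moreover have "rotation n i \<noteq> \<one>\<^bsub>dihedral_group n\<^esub>"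
    using inj_onD[OF carrier_dihedral_group(2)[OF n0], of i 0] i unfolding rotation_0[symmetric] by auto
  then have "ord (rotation n i) \<noteq> 1" using ord_eq_1[OF car] by simp
  ultimately show ?thesis using n by (auto simp: prime_nat_iff)
qed

section \<open>The expectation\<close>

lemma sum_dihedral_group:
  fixes F :: "dihedral_gen word set \<Rightarrow> real"
  assumes n: "n > 0"
  shows "sum F (carrier (dihedral_group n))
    = F \<one>\<^bsub>dihedral_group n\<^esub> + (\<Sum>i\<in>{0<..<n}. F (rotation n i)) + (\<Sum>i<n. F (reflection n i))"
proof -
  have "sum F (carrier (dihedral_group n)) = (\<Sum>i<n. F (rotation n i)) + (\<Sum>i<n. F (reflection n i))"
    unfolding carrier_dihedral_group(1)[OF n]
    by (subst sum.union_disjoint)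
       (auto simp: carrier_dihedral_group[OF n] sum.reindex)
  moreover have "{..<n} = insert 0 {0<..<n}" using n by auto
  ultimately show ?thesis by (simp add: rotation_0)
qed

lemma coeff_cycle_poly_2_power: "coeff (cycle_poly 2 ^ q) m = 2 ^ m * (q choose m)"
proof (cases "m \<le> q")
  case True
  then show ?thesis by (simp add: cycle_poly_2 coeff_linear_poly_power)
next
  case False
  have "degree ([:1, 2:] ^ q :: nat poly) \<le> q"
    using degree_power_le[of "[:1, 2::nat:]" q] by simp
  with False show ?thesis by (simp add: cycle_poly_2 coeff_eq_0)
qed

text \<open>
  The convolution square, with its terms \<open>k = 0\<close> and \<open>k = m\<close> split off: there one factor is the
  constant coefficient 1, which the formula \<open>n/k \<cdot> binom (n-k-1) (k-1)\<close> does not cover.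
\<close>

lemma coeff_cycle_poly_square:
  assumes n: "n \<ge> 2" and m: "m \<ge> 1"
  shows "real (coeff (cycle_poly n ^ 2) m)
    = 2 * real n * real (ibinom (int n - int m - 1) (m - 1)) / real m
      + (real n)\<^sup>2 * (\<Sum>k = 1..m - 1.
          real (ibinom (int n + int k - int m - 1) (m - k - 1))
            * real (ibinom (int n - int k - 1) (k - 1)) / (real k * (real m - real k)))"
proof -
  define c where "c k = real (coeff (cycle_poly n) k)" for k
  have c0: "c 0 = 1" by (simp add: c_def coeff_cycle_poly_0[OF n])
  have c: "c k = real n * real (ibinom (int n - int k - 1) (k - 1)) / real k" if "k \<ge> 1" for k
    using arg_cong[OF coeff_cycle_poly[OF n that], of real] that by (simp add: c_def field_simps)
  have "real (coeff (cycle_poly n ^ 2) m) = (\<Sum>k\<le>m. c k * c (m - k))"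
    by (simp add: power2_eq_square coeff_mult c_def)
  also have "{..m} = insert 0 (insert m {1..m - 1})" using m by auto
  also have "(\<Sum>k\<in>insert 0 (insert m {1..m - 1}). c k * c (m - k))
      = 2 * c m + (\<Sum>k = 1..m - 1. c k * c (m - k))"
    using m by (simp add: c0)
  also have "(\<Sum>k = 1..m - 1. c k * c (m - k)) = (real n)\<^sup>2 * (\<Sum>k = 1..m - 1.
          real (ibinom (int n + int k - int m - 1) (m - k - 1))
            * real (ibinom (int n - int k - 1) (k - 1)) / (real k * (real m - real k)))"
    unfolding sum_distrib_left
  proof (rule sum.cong)
    fix k assume "k \<in> {1..m - 1}"
    then have k: "1 \<le> k" "k < m" "1 \<le> m - k" using m by auto
    have idx: "int n - int (m - k) - 1 = int n + int k - int m - 1" using k by simp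
    have "c (m - k) = real n * real (ibinom (int n + int k - int m - 1) (m - k - 1)) / (real m - real k)"
      using c[OF k(3)] k(2) unfolding idx by (simp add: of_nat_diff)
    then show "c k * c (m - k) = (real n)\<^sup>2 *
        (real (ibinom (int n + int k - int m - 1) (m - k - 1))
          * real (ibinom (int n - int k - 1) (k - 1)) / (real k * (real m - real k)))"
      using k by (simp add: c power2_eq_square)
  qed simp
  finally show ?thesis using c[OF m] by simp
qed

theorem theorem1p9:
  fixes n m :: nat
  assumes "prime n" and "1 \<le> m" and "m \<le> 2 * n"
  shows "measure_pmf.expectation
           (pmf_of_set (subsets_of_size (carrier (dihedral_group n)) m))
           (\<lambda>A. real (card (difference_set (dihedral_group n) A)))
       = 2 * real n
         - (real n * real m * 2 ^ m * real (n choose m)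
              + 2 * real n * (real n - 1) * real (ibinom (int n - int m - 1) (m - 1)))
           / (real m * real ((2 * n) choose m))
         - (real n)\<^sup>2 * (real n - 1) / real ((2 * n) choose m)
           * (\<Sum>k = 1..m - 1.
                real (ibinom (int n + int k - int m - 1) (m - k - 1))
                  * real (ibinom (int n - int k - 1) (k - 1))
                  / (real k * (real m - real k)))"
proof -
  interpret group "dihedral_group n" by (rule group_dihedral_group)
  let ?G = "dihedral_group n"
  let ?F = "\<lambda>g. real (coeff (indep_poly (\<lambda>x. g \<otimes>\<^bsub>?G\<^esub> x) (carrier ?G)) m)"
  have n: "n \<ge> 2" "n > 0" using assms(1) by (simp_all add: prime_ge_2_nat prime_gt_0_nat)
  have order: "Coset.order ?G = 2 * n" by (rule order_dihedral_group[OF n(2)])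
  then have fin: "finite (carrier ?G)"
    using n by (simp add: order_def card_ge_0_finite)
  have car: "rotation n i \<in> carrier ?G" "reflection n i \<in> carrier ?G" if "i < n" for i
    using that by (auto simp: carrier_dihedral_group(1)[OF n(2)])
  have one: "?F \<one>\<^bsub>?G\<^esub> = 0"
  proof -
    have "card A \<noteq> m" if "A \<in> indep_sets (\<lambda>x. \<one>\<^bsub>?G\<^esub> \<otimes>\<^bsub>?G\<^esub> x) (carrier ?G)" for A
    proof -
      have "a \<notin> A" for a
        using that l_one[of a] unfolding indep_sets_def by force
      then have "A = {}" by blast
      with assms(2) show ?thesis by simp
    qed
    then have "{A \<in> indep_sets (\<lambda>x. \<one>\<^bsub>?G\<^esub> \<otimes>\<^bsub>?G\<^esub> x) (carrier ?G). card A = m} = {}"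
      by blast
    then show ?thesis unfolding coeff_indep_poly[OF fin] by (simp only: card.empty of_nat_0)
  qed
  define I where "I = real (ibinom (int n - int m - 1) (m - 1))"
  define B where "B = real ((2 * n) choose m)"
  define S where "S = (\<Sum>k = 1..m - 1.
                real (ibinom (int n + int k - int m - 1) (m - k - 1))
                  * real (ibinom (int n - int k - 1) (k - 1))
                  / (real k * (real m - real k)))"
  have rot: "?F (rotation n i) = 2 * real n * I / real m + (real n)\<^sup>2 * S" if "i \<in> {0<..<n}" for i
    using that n assms(2) indep_poly_translation[OF fin car(1)[of i], of 2] order
    by (simp add: ord_rotation[OF assms(1)] coeff_cycle_poly_square I_def S_def)
  have ref: "?F (reflection n i) = 2 ^ m * real (n choose m)" if "i < n" for i
    using indep_poly_translation[OF fin car(2)[OF that], of n] that order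
    by (simp add: ord_reflection[OF n(2)] coeff_cycle_poly_2_power)
  have "(\<Sum>g\<in>carrier ?G. ?F g)
      = (real n - 1) * (2 * real n * I / real m + (real n)\<^sup>2 * S) + real n * (2 ^ m * real (n choose m))"
    unfolding sum_dihedral_group[OF n(2)] one using n by (simp add: rot ref of_nat_diff)
  moreover have "B > 0" "real m > 0" using assms by (simp_all add: B_def)
  moreover have "2 * x - ((x - 1) * (2 * x * I / y + x\<^sup>2 * S) + x * P) / B
      = 2 * x - (x * y * P + 2 * x * (x - 1) * I) / (y * B) - x\<^sup>2 * (x - 1) / B * S"
    if "B > 0" "y > 0" for x y P :: real
    using that by (simp add: divide_simps) (simp add: algebra_simps)
  ultimately show ?thesis
    unfolding expectation_card_difference_set[OF fin assms(3)[folded order]] order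
      I_def[symmetric] B_def[symmetric] S_def[symmetric]
    by (simp add: mult.assoc)
qed

end
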